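(* If $G_1$ and $G_2$ are cospectral for the $\mathcal{D}$ matrix with $S=B_1\oplus \cdots\oplus B_\ell$ as a similarity matrix satisfying $SJ=JS$, then for the similarity vertex partitioning $V_1,\ldots,V_\ell$ the graphs $\displaystyle G_1\circ_{i=1}^\ell{}_{V_i}H_i$ and $\displaystyle G_2\circ_{i=1}^\ell{}_{V_i}H_i$ are cospectral for the $\mathcal{D}$ (distance) matrix for any choice of $H_1,\ldots,H_\ell$.
   Context: All graphs are simple, undirected, and connected (including the rooted graphs $H_i$). The distance matrix $\mathcal{D}_G$ has $(u,v)$ entry $\dist_G(u,v)$. $G_1$ and $G_2$ have the same vertex set labeling; $S$ is an invertible block diagonal matrix $B_1\oplus\cdots\oplus B_\ell$ with $S\mathcal{D}_{G_1}S^{-1}=\mathcal{D}_{G_2}$, and the similarity vertex partitioning $V_1,\ldots,V_\ell$ assigns to $V_i$ the vertices indexing the rows of block $B_i$. $J$ is the all-ones matrix. Given rooted graphs $H_1,\ldots,H_\ell$, $\displaystyle G\circ_{i=1}^\ell{}_{V_i}H_i$ denotes the graph obtained from the disjoint union of $G$ and, for each $i$ and each $v\in V_i$, a separate copy of $H_i$, by identifying the root of that copy of $H_i$ with $v$. *)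

theory Defs
  imports
    "Jordan_Normal_Form.Char_Poly"
    "Graph_Theory.Digraph_Component"
begin

text \<open>
  Undirected graphs are symmetric digraphs without parallel arcs; \<open>pair_graph\<close>
  adds finiteness and the absence of loops. The graph notion of connectedness, which includes
  nonemptiness, is qualified because of the topological constant of the same name.
\<close>

definition connected_simple_graph :: "'a pair_pre_digraph \<Rightarrow> bool" where
  "connected_simple_graph G \<longleftrightarrow>
     pair_graph G \<and> Digraph_Component.connected (with_proj G)"

definition rooted_graph :: "'a pair_pre_digraph \<Rightarrow> 'a \<Rightarrow> bool" where
  "rooted_graph H r \<longleftrightarrow> connected_simple_graph H \<and> r \<in> pverts H"

text \<open>The length of a shortest path; meaningful only if \<open>u\<close> and \<open>v\<close> are joined by a path.\<close>

definition graph_dist :: "'a pair_pre_digraph \<Rightarrow> 'a \<Rightarrow> 'a \<Rightarrow> nat" where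
  "graph_dist G u v =
     (LEAST k. \<exists>p. pre_digraph.apath (with_proj G) u p v \<and> length p = k)"

text \<open>A list \<open>vs\<close> fixes which vertex indexes which row and column.\<close>

definition vertex_enum :: "'a pair_pre_digraph \<Rightarrow> 'a list \<Rightarrow> bool" where
  "vertex_enum G vs \<longleftrightarrow> distinct vs \<and> set vs = pverts G"

definition dist_mat :: "'a pair_pre_digraph \<Rightarrow> 'a list \<Rightarrow> complex mat" where
  "dist_mat G vs =
     mat (length vs) (length vs) (\<lambda>(i, j). of_nat (graph_dist G (vs ! i) (vs ! j)))"

text \<open>The multiset of eigenvalues, with algebraic multiplicities.\<close>

definition spectrum_mset :: "complex mat \<Rightarrow> complex multiset" where
  "spectrum_mset A = proots (char_poly A)"

text \<open>
  The spectrum of the distance matrix does not depend on the enumeration of the vertices, so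
  quantifying over all enumerations is harmless. Finiteness guarantees that enumerations exist.
\<close>

definition dist_cospectral :: "'a pair_pre_digraph \<Rightarrow> 'b pair_pre_digraph \<Rightarrow> bool" where
  "dist_cospectral G G' \<longleftrightarrow> finite (pverts G) \<and> finite (pverts G') \<and>
     (\<forall>vs ws. vertex_enum G vs \<longrightarrow> vertex_enum G' ws \<longrightarrow>
        spectrum_mset (dist_mat G vs) = spectrum_mset (dist_mat G' ws))"

definition all_ones_mat :: "nat \<Rightarrow> complex mat" where
  "all_ones_mat n = mat n n (\<lambda>_. 1)"

text \<open>
  The vertices (listed in the order of the rows) that index the rows of the \<open>i\<close>-th diagonal block
  of \<open>diag_block_mat Bs\<close>; blocks are numbered from 0.
\<close>

definition block_part :: "complex mat list \<Rightarrow> 'a list \<Rightarrow> nat \<Rightarrow> 'a set" where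
  "block_part Bs vs i =
     {vs ! k | k. (\<Sum>j<i. dim_row (Bs ! j)) \<le> k \<and> k < (\<Sum>j\<le>i. dim_row (Bs ! j))}"

text \<open>
  Attaching, for each \<open>i < l\<close> and each \<open>v \<in> V i\<close>, a separate copy of \<open>H i\<close> to \<open>G\<close> by identifying its
  root \<open>r i\<close> with \<open>v\<close>. The pair \<open>(v, h)\<close> is the vertex \<open>h\<close> of the copy of \<open>H i\<close> attached at \<open>v\<close>. In
  particular \<open>(v, r i)\<close> is the vertex that results from identifying the root of this copy with \<open>v\<close>,
  so it also carries the edges of \<open>G\<close> at \<open>v\<close>. The sets \<open>V i\<close> are meant to partition \<open>pverts G\<close>.
\<close>

definition rooted_product ::
  "'a pair_pre_digraph \<Rightarrow> nat \<Rightarrow> (nat \<Rightarrow> 'a set) \<Rightarrow> (nat \<Rightarrow> 'h pair_pre_digraph) \<Rightarrow> (nat \<Rightarrow> 'h)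
    \<Rightarrow> ('a \<times> 'h) pair_pre_digraph" where
  "rooted_product G l V H r = \<lparr>
     pverts = {(v, h) | i v h. i < l \<and> v \<in> V i \<and> h \<in> pverts (H i)},
     parcs =
       {((v, r i), (w, r j)) | i j v w.
          i < l \<and> j < l \<and> v \<in> V i \<and> w \<in> V j \<and> (v, w) \<in> parcs G} \<union>
       {((v, h), (v, h')) | i v h h'. i < l \<and> v \<in> V i \<and> (h, h') \<in> parcs (H i)} \<rparr>"

end

theory Submission
  imports Defs
begin

text \<open>
  Index the rows of the product by pairs \<open>(v, h)\<close> and lift \<open>S\<close> to the matrix \<open>T\<close> whose entry at
  \<open>(v, h), (w, k)\<close> is \<open>S v w\<close> if \<open>h = k\<close> and \<open>v, w\<close> lie in the same block, and \<open>0\<close> otherwise.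
  A distance in the product is a sum of the distance in \<open>G\<close>, a term supported on \<open>v = w\<close> that
  depends only on the block, and a term in \<open>(v, h)\<close> plus a term in \<open>(w, k)\<close> that also see \<open>v\<close> and
  \<open>w\<close> only through their blocks. \<open>T\<close> intertwines the first summands since \<open>S D\<^sub>1 = D\<^sub>2 S\<close>, commutes
  with the second since \<open>S\<close> is block diagonal, and intertwines the last since \<open>S J = J S\<close> makes all row
  and column sums of \<open>S\<close> equal. The lift of \<open>S\<^sup>-\<^sup>1\<close> is a right inverse of \<open>T\<close>; block
  diagonality of \<open>S\<close> alone suffices for that.
\<close>

section \<open>Graph distance characterised by local conditions\<close>

text \<open>
  These local conditions determine the distance function; they can be checked edge by edge,
  without handling shortest paths in the product.
\<close>

definition is_distance :: "'a pair_pre_digraph \<Rightarrow> ('a \<Rightarrow> 'a \<Rightarrow> nat) \<Rightarrow> bool" where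
  "is_distance G f \<longleftrightarrow>
     (\<forall>u\<in>pverts G. f u u = 0) \<and>
     (\<forall>u\<in>pverts G. \<forall>(w, v)\<in>parcs G. f u v \<le> Suc (f u w)) \<and>
     (\<forall>u\<in>pverts G. \<forall>v\<in>pverts G. u \<noteq> v \<longrightarrow> (\<exists>w. (w, v) \<in> parcs G \<and> f u v = Suc (f u w)))"

text \<open>Each induction step cuts a cycle out of the walk, which cannot lengthen it.\<close>

lemma (in wf_digraph) awalk_shorten_apath:
  assumes "awalk u p v"
  shows "\<exists>q. apath u q v \<and> length q \<le> length p"
  using assms
proof (induct rule: awalk_to_apath_induct)
  case (path p)
  then show ?case by (auto intro: awalkI_apath simp: apath_def)
next
  case (decomp p q r s)
  then have "p = q @ r @ s" using awalk_cyc_decomp_has_prop[of u p v] by auto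
  then have "length (q @ s) \<le> length p" by simp
  then show ?case using decomp(4) le_trans by blast
qed

context pair_wf_digraph
begin

text \<open>\<open>graph_dist\<close> minimises over paths. Extending the bound to walks lets walks
  be concatenated below without checking that their vertices stay distinct.\<close>

lemma graph_dist_le:
  assumes "awalk u p v"
  shows "graph_dist G u v \<le> length p"
proof -
  obtain q where q: "apath u q v" "length q \<le> length p"
    using awalk_shorten_apath[OF assms] by blast
  have "graph_dist G u v \<le> length q"
    unfolding graph_dist_def using q(1) by (intro Least_le) blast
  then show ?thesis using q(2) by simp
qed

lemma graph_dist_attained:
  assumes "reachable (with_proj G) u v"
  shows "\<exists>p. apath u p v \<and> length p = graph_dist G u v"
proof -
  have "\<exists>k. \<exists>p. apath u p v \<and> length p = k"
    using assms reachable_apath by blast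
  then show ?thesis unfolding graph_dist_def by (rule LeastI_ex)
qed

text \<open>Appending an arc to a shortest path gives the upper bound; the last arc of a shortest
  path supplies the predecessor.\<close>

lemma is_distance_graph_dist:
  assumes conn: "\<And>u v. u \<in> pverts G \<Longrightarrow> v \<in> pverts G \<Longrightarrow> reachable (with_proj G) u v"
  shows "is_distance G (graph_dist G)"
  unfolding is_distance_def
proof (intro conjI ballI impI)
  fix u assume "u \<in> pverts G"
  then have "awalk u [] u" by (simp add: awalk_Nil_iff)
  then show "graph_dist G u u = 0" using graph_dist_le by fastforce
next
  fix u e assume u: "u \<in> pverts G" and e: "e \<in> parcs G"
  show "case e of (w, v) \<Rightarrow> graph_dist G u v \<le> Suc (graph_dist G u w)"
  proof (cases e)
    case (Pair w v)
    with e have wv: "w \<in> pverts G" "(w, v) \<in> parcs G" by (auto dest: in_arcsD1)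
    obtain p where p: "apath u p w" "length p = graph_dist G u w"
      using graph_dist_attained[OF conn[OF u wv(1)]] by blast
    have "awalk w [(w, v)] v" using arc_implies_awalk[of "(w, v)"] wv by simp
    then have "awalk u (p @ [(w, v)]) v"
      using p(1) by (meson awalkI_apath awalk_appendI)
    from graph_dist_le[OF this] p(2) Pair show ?thesis by simp
  qed
next
  fix u v assume u: "u \<in> pverts G" and v: "v \<in> pverts G" and ne: "u \<noteq> v"
  obtain p where p: "apath u p v" "length p = graph_dist G u v"
    using graph_dist_attained[OF conn[OF u v]] by blast
  have "p \<noteq> []" using p(1) ne by (auto simp: apath_Nil_iff)
  then obtain q e where pq: "p = q @ [e]" by (metis rev_exhaust)
  have aw: "awalk u (q @ [e]) v" using awalkI_apath[OF p(1)] unfolding pq .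
  obtain w where ew: "e = (w, v)" "(w, v) \<in> parcs G" "awalk u q w"
    using aw by (cases e) (auto simp: awalk_Cons_iff awalk_Nil_iff)
  have w: "w \<in> pverts G" using ew(2) by (auto dest: in_arcsD1)
  \<comment> \<open>A shortest path to \<open>v\<close> without its last arc bounds the distance to
    \<open>w\<close>; extending a shortest path to \<open>w\<close> by that arc gives the opposite
    inequality, so the distances differ by exactly one.\<close>
  have le: "graph_dist G u w \<le> length q" by (rule graph_dist_le[OF ew(3)])
  obtain p' where p': "apath u p' w" "length p' = graph_dist G u w"
    using graph_dist_attained[OF conn[OF u w]] by blast
  have "awalk w [(w, v)] v" using arc_implies_awalk[of "(w, v)"] ew(2) by simp
  then have "awalk u (p' @ [(w, v)]) v"
    using p'(1) by (meson awalkI_apath awalk_appendI)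
  from graph_dist_le[OF this] p'(2) have "graph_dist G u v \<le> Suc (graph_dist G u w)" by simp
  then have "graph_dist G u v = Suc (graph_dist G u w)" using le p(2) pq by simp
  then show "\<exists>w. (w, v) \<in> parcs G \<and> graph_dist G u v = Suc (graph_dist G u w)"
    using ew(2) by blast
qed

text \<open>Along a walk \<open>f u\<close> starts at 0 and grows by at most one per arc. The
  induction removes the last arc, since the local conditions control \<open>f\<close> in its second
  argument.\<close>

lemma is_distance_le_length:
  assumes f: "is_distance G f" and u: "u \<in> pverts G" and "awalk u p v"
  shows "f u v \<le> length p"
  using assms(3)
proof (induct p arbitrary: v rule: rev_induct)
  case Nil
  then show ?case using f by (auto simp: awalk_Nil_iff is_distance_def)
next
  case (snoc e p)
  obtain w where w: "e = (w, v)" "(w, v) \<in> parcs G" "awalk u p w"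
    using snoc.prems by (cases e) (auto simp: awalk_Cons_iff awalk_Nil_iff)
  have "f u v \<le> Suc (f u w)" using f u w(2) by (auto simp: is_distance_def)
  then show ?case using snoc.hyps[OF w(3)] by simp
qed

text \<open>Stepping back to a predecessor lowers \<open>f u\<close> by one, so the descent ends,
  and the third local condition lets it end only at \<open>u\<close>. The arcs passed form the
  walk.\<close>

lemma is_distance_awalk:
  assumes f: "is_distance G f" and u: "u \<in> pverts G" and "v \<in> pverts G"
  shows "\<exists>p. awalk u p v \<and> length p = f u v"
  using assms(3)
proof (induct "f u v" arbitrary: v rule: less_induct)
  case less
  show ?case
  proof (cases "u = v")
    case True
    then show ?thesis using f u by (auto simp: is_distance_def awalk_Nil_iff)
  next
    case False
    then obtain w where w: "(w, v) \<in> parcs G" "f u v = Suc (f u w)"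
      using f u less.prems unfolding is_distance_def by blast
    have "w \<in> pverts G" using w(1) by (auto dest: in_arcsD1)
    then obtain p where p: "awalk u p w" "length p = f u w"
      using less.hyps[of w] w(2) by auto
    have "awalk w [(w, v)] v" using arc_implies_awalk[of "(w, v)"] w(1) by simp
    then have "awalk u (p @ [(w, v)]) v" using p(1) by (meson awalk_appendI)
    then show ?thesis using p(2) w(2) by (metis length_append_singleton)
  qed
qed

text \<open>The walk of length \<open>f u v\<close> also witnesses reachability, so checking the
  local conditions for a product settles its connectedness at the same time.\<close>

lemma graph_dist_eqI:
  assumes f: "is_distance G f" and u: "u \<in> pverts G" and v: "v \<in> pverts G"
  shows "graph_dist G u v = f u v"
proof (rule antisym)
  obtain p where p: "awalk u p v" "length p = f u v"
    using is_distance_awalk[OF assms] by blast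
  show "graph_dist G u v \<le> f u v" using graph_dist_le[OF p(1)] p(2) by simp
  have "reachable (with_proj G) u v" using p(1) by (rule reachable_awalkI)
  then obtain q where q: "apath u q v" "length q = graph_dist G u v"
    using graph_dist_attained by blast
  show "f u v \<le> graph_dist G u v"
    using is_distance_le_length[OF f u awalkI_apath[OF q(1)]] q(2) by simp
qed

end

lemma connected_simple_graph_is_distance:
  assumes "connected_simple_graph G"
  shows "is_distance G (graph_dist G)"
proof -
  interpret pair_graph G using assms by (simp add: connected_simple_graph_def)
  have "strongly_connected (with_proj G)"
    using assms sym_arcs symmetric_connected_imp_strongly_connected
    by (simp add: connected_simple_graph_def)
  then show ?thesis
    by (intro is_distance_graph_dist) (auto simp: strongly_connected_def)
qed

lemma connected_simple_graph_wf:
  assumes "connected_simple_graph G"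
  shows "pair_wf_digraph G" and "finite (pverts G)"
proof -
  interpret pair_graph G using assms by (simp add: connected_simple_graph_def)
  show "pair_wf_digraph G" by unfold_locales
  show "finite (pverts G)" by (rule pair_finite_verts)
qed

section \<open>Distances in the rooted product\<close>

text \<open>Each copy meets the rest of the product only in its root \<open>\<rho> v\<close>. A
  shortest path between different copies therefore runs to the first root, through the base graph,
  and on from the second root, while one within a copy stays there. Copies are indexed by base
  vertices here, not by blocks.\<close>

definition product_dist ::
  "('a \<Rightarrow> 'a \<Rightarrow> nat) \<Rightarrow> ('a \<Rightarrow> 'h \<Rightarrow> 'h \<Rightarrow> nat) \<Rightarrow> ('a \<Rightarrow> 'h) \<Rightarrow> 'a \<times> 'h \<Rightarrow> 'a \<times> 'h \<Rightarrow> nat" where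
  "product_dist d e \<rho> x y =
     (if fst x = fst y then e (fst x) (snd x) (snd y)
      else e (fst x) (snd x) (\<rho> (fst x)) + d (fst x) (fst y) + e (fst y) (\<rho> (fst y)) (snd y))"

text \<open>Every arc lies either in the base graph or in a single copy, so each local condition
  reduces to the same condition for \<open>d\<close> or for one \<open>e v\<close>.\<close>

lemma is_distance_product:
  assumes d: "is_distance G d"
    and e: "\<And>v. v \<in> pverts G \<Longrightarrow> is_distance (K v) (e v)"
    and root: "\<And>v. v \<in> pverts G \<Longrightarrow> \<rho> v \<in> pverts (K v)"
    and G: "pair_wf_digraph G"
    and K: "\<And>v. v \<in> pverts G \<Longrightarrow> pair_wf_digraph (K v)"
    and verts: "pverts P = Sigma (pverts G) (\<lambda>v. pverts (K v))"
    and arcs: "parcs P = {((v, \<rho> v), (w, \<rho> w)) | v w. (v, w) \<in> parcs G} \<union>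
                 {((v, h), (v, h')) | v h h'. v \<in> pverts G \<and> (h, h') \<in> parcs (K v)}"
  shows "is_distance P (product_dist d e \<rho>)"
proof -
  have GV: "v \<in> pverts G" "w \<in> pverts G" if "(v, w) \<in> parcs G" for v w
    using pair_wf_digraph.in_arcsD1[OF G that] pair_wf_digraph.in_arcsD2[OF G that] by auto
  have KV: "h \<in> pverts (K v)" if "v \<in> pverts G" "(h, h') \<in> parcs (K v)" for v h h'
    using pair_wf_digraph.in_arcsD1[OF K[OF that(1)] that(2)] by auto
  have d0: "d v v = 0" if "v \<in> pverts G" for v
    using d that by (auto simp: is_distance_def)
  have d1: "d u v \<le> Suc (d u w)" if "u \<in> pverts G" "(w, v) \<in> parcs G" for u v w
    using d that by (auto simp: is_distance_def)
  have d2: "\<exists>w. (w, v) \<in> parcs G \<and> d u v = Suc (d u w)"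
    if "u \<in> pverts G" "v \<in> pverts G" "u \<noteq> v" for u v
    using d that by (auto simp: is_distance_def)
  have e0: "e v h h = 0" if "v \<in> pverts G" "h \<in> pverts (K v)" for v h
    using e[OF that(1)] that(2) by (auto simp: is_distance_def)
  have e1: "e v h h' \<le> Suc (e v h k)"
    if "v \<in> pverts G" "h \<in> pverts (K v)" "(k, h') \<in> parcs (K v)" for v h h' k
    using e[OF that(1)] that(2,3) by (auto simp: is_distance_def)
  have e2: "\<exists>k. (k, h') \<in> parcs (K v) \<and> e v h h' = Suc (e v h k)"
    if "v \<in> pverts G" "h \<in> pverts (K v)" "h' \<in> pverts (K v)" "h \<noteq> h'" for v h h'
    using e[OF that(1)] that(2-4) by (auto simp: is_distance_def)
  note e0r = e0[OF _ root]
  show ?thesis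
    unfolding is_distance_def
  proof (intro conjI ballI impI)
    fix x assume "x \<in> pverts P"
    then show "product_dist d e \<rho> x x = 0"
      by (auto simp: verts product_dist_def e0)
  next
    fix x a assume x: "x \<in> pverts P" and a: "a \<in> parcs P"
    obtain v h where vh: "x = (v, h)" "v \<in> pverts G" "h \<in> pverts (K v)"
      using x by (auto simp: verts)
    from a consider w w' where "a = ((w, \<rho> w), (w', \<rho> w'))" "(w, w') \<in> parcs G"
      | w k k' where "a = ((w, k), (w, k'))" "w \<in> pverts G" "(k, k') \<in> parcs (K w)"
      by (auto simp: arcs)
    then show "case a of (y, z) \<Rightarrow> product_dist d e \<rho> x z \<le> Suc (product_dist d e \<rho> x y)"
    proof cases
      case 1
      \<comment> \<open>If \<open>v\<close> equals \<open>w\<close> or \<open>w'\<close>, the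
        definition of \<open>product_dist\<close> switches branch; the zero distances
        \<open>d v v\<close> and from a root to itself make the two branches agree at a
        root.\<close>
      have "d v w' \<le> Suc (d v w)" using d1 vh 1 by blast
      then show ?thesis
        using GV[OF 1(2)] vh 1(1) d0[of v] by (auto simp: product_dist_def e0r)
    next
      case 2
      then show ?thesis
        using vh e1[OF vh(2,3), of k k'] e1[OF 2(2) root[OF 2(2)] 2(3)]
        by (auto simp: product_dist_def)
    qed
  next
    fix x z assume x: "x \<in> pverts P" and z: "z \<in> pverts P" and ne: "x \<noteq> z"
    obtain v h where vh: "x = (v, h)" "v \<in> pverts G" "h \<in> pverts (K v)"
      using x by (auto simp: verts)
    obtain w k where wk: "z = (w, k)" "w \<in> pverts G" "k \<in> pverts (K w)"
      using z by (auto simp: verts)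
    \<comment> \<open>The last arc of a shortest path to \<open>z\<close> lies in the copy
      containing \<open>z\<close>, unless \<open>z\<close> is the root of a copy other than that of
      \<open>x\<close>; then it lies in the base graph.\<close>
    consider "v = w" "h \<noteq> k" | "v \<noteq> w" "k \<noteq> \<rho> w" | "v \<noteq> w" "k = \<rho> w"
      using ne vh wk by auto
    then show "\<exists>y. (y, z) \<in> parcs P \<and> product_dist d e \<rho> x z = Suc (product_dist d e \<rho> x y)"
    proof cases
      case 1
      obtain k' where k': "(k', k) \<in> parcs (K v)" "e v h k = Suc (e v h k')"
        using e2[OF vh(2,3), of k] wk 1 by auto
      show ?thesis
        by (rule exI[of _ "(v, k')"]) (use 1 k' vh wk in \<open>auto simp: arcs product_dist_def\<close>)
    next
      case 2
      obtain k' where k': "(k', k) \<in> parcs (K w)" "e w (\<rho> w) k = Suc (e w (\<rho> w) k')"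
        using e2[OF wk(2) root[OF wk(2)] wk(3)] 2 by auto
      show ?thesis
        by (rule exI[of _ "(w, k')"]) (use 2 k' vh wk in \<open>auto simp: arcs product_dist_def\<close>)
    next
      case 3
      obtain w' where w': "(w', w) \<in> parcs G" "d v w = Suc (d v w')"
        using d2[OF vh(2) wk(2) 3(1)] by auto
      have "((w', \<rho> w'), z) \<in> parcs P" using w' 3 wk by (auto simp: arcs)
      moreover have "product_dist d e \<rho> x z = Suc (product_dist d e \<rho> x (w', \<rho> w'))"
        using 3 w' vh wk GV[OF w'(1)] d0[of v] by (auto simp: product_dist_def e0r)
      ultimately show ?thesis by blast
    qed
  qed
qed

text \<open>An index \<open>i\<close> occurring in \<open>rooted_product\<close> is determined by
  its vertex as \<open>b v\<close>. Rewriting vertices and arcs accordingly yields the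
  vertex-indexed family \<open>H (b v)\<close> required by \<open>is_distance_product\<close>;
  uniqueness of the distance function does the rest.\<close>

lemma graph_dist_rooted_product:
  assumes G: "connected_simple_graph G"
    and H: "\<And>i. i < l \<Longrightarrow> rooted_graph (H i) (r i)"
    and b: "\<And>v. v \<in> pverts G \<Longrightarrow> b v < l"
    and V: "\<And>i v. i < l \<Longrightarrow> v \<in> V i \<longleftrightarrow> v \<in> pverts G \<and> b v = i"
  defines "P \<equiv> rooted_product G l V H r"
  shows "pverts P = Sigma (pverts G) (\<lambda>v. pverts (H (b v)))"
    and "\<And>x y. x \<in> pverts P \<Longrightarrow> y \<in> pverts P \<Longrightarrow> graph_dist P x y =
      product_dist (graph_dist G) (\<lambda>v. graph_dist (H (b v))) (\<lambda>v. r (b v)) x y"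
proof -
  have wfG: "pair_wf_digraph G"
    using G by (rule connected_simple_graph_wf)
  have wfH: "pair_wf_digraph (H i)" if "i < l" for i
    using H[OF that] by (simp add: rooted_graph_def connected_simple_graph_wf)
  have GV: "v \<in> pverts G" "w \<in> pverts G" if "(v, w) \<in> parcs G" for v w
    using pair_wf_digraph.in_arcsD1[OF wfG that] pair_wf_digraph.in_arcsD2[OF wfG that] by auto
  have HV: "h \<in> pverts (H i)" "h' \<in> pverts (H i)" if "i < l" "(h, h') \<in> parcs (H i)" for i h h'
    using pair_wf_digraph.in_arcsD1[OF wfH that(2)] pair_wf_digraph.in_arcsD2[OF wfH that(2)] that(1)
    by auto
  show verts: "pverts P = Sigma (pverts G) (\<lambda>v. pverts (H (b v)))"
    using b V by (fastforce simp: P_def rooted_product_def)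
  have arcs: "parcs P = {((v, r (b v)), (w, r (b w))) | v w. (v, w) \<in> parcs G} \<union>
      {((v, h), (v, h')) | v h h'. v \<in> pverts G \<and> (h, h') \<in> parcs (H (b v))}"
    (is "_ = ?A \<union> ?B")
  proof -
    have "?A = {((v, r i), (w, r j)) | i j v w.
        i < l \<and> j < l \<and> v \<in> V i \<and> w \<in> V j \<and> (v, w) \<in> parcs G}" (is "_ = ?A'")
    proof (intro subset_antisym subsetI)
      fix x assume "x \<in> ?A"
      then obtain v w where x: "x = ((v, r (b v)), (w, r (b w)))" "(v, w) \<in> parcs G" by blast
      have "b v < l \<and> b w < l \<and> v \<in> V (b v) \<and> w \<in> V (b w)"
        using GV[OF x(2)] b V by simp
      then show "x \<in> ?A'" using x by blast
    next
      fix x assume "x \<in> ?A'"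
      then obtain i j v w where x: "x = ((v, r i), (w, r j))" "(v, w) \<in> parcs G"
        and ij: "i < l" "j < l" "v \<in> V i" "w \<in> V j" by blast
      have "b v = i" "b w = j" using V ij by simp_all
      then show "x \<in> ?A" using x by blast
    qed
    moreover have "?B = {((v, h), (v, h')) | i v h h'. i < l \<and> v \<in> V i \<and> (h, h') \<in> parcs (H i)}"
      (is "_ = ?B'")
    proof (intro subset_antisym subsetI)
      fix x assume "x \<in> ?B"
      then obtain v h h' where x: "x = ((v, h), (v, h'))" "(h, h') \<in> parcs (H (b v))"
        and v: "v \<in> pverts G" by blast
      have "b v < l \<and> v \<in> V (b v)" using v b V by simp
      then show "x \<in> ?B'" using x by blast
    next
      fix x assume "x \<in> ?B'"
      then obtain i v h h' where x: "x = ((v, h), (v, h'))" "(h, h') \<in> parcs (H i)"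
        and i: "i < l" "v \<in> V i" by blast
      have "b v = i" "v \<in> pverts G" using V i by simp_all
      then show "x \<in> ?B" using x by blast
    qed
    ultimately show ?thesis by (simp add: P_def rooted_product_def)
  qed
  have root: "r (b v) \<in> pverts (H (b v))" if "v \<in> pverts G" for v
    using H[OF b[OF that]] by (simp add: rooted_graph_def)
  have "is_distance P (product_dist (graph_dist G) (\<lambda>v. graph_dist (H (b v))) (\<lambda>v. r (b v)))"
    using G H b
    by (intro is_distance_product[where K = "\<lambda>v. H (b v)" and G = G] verts arcs root wfG wfH
        connected_simple_graph_is_distance) (auto simp: rooted_graph_def)
  moreover have "pair_wf_digraph P"
    by unfold_locales (use GV HV[OF b] root in \<open>auto simp: arcs verts\<close>)
  ultimately show "graph_dist P x y =
      product_dist (graph_dist G) (\<lambda>v. graph_dist (H (b v))) (\<lambda>v. r (b v)) x y"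
    if "x \<in> pverts P" "y \<in> pverts P" for x y
    using that by (intro pair_wf_digraph.graph_dist_eqI)
qed

section \<open>Lifting the similarity to the product\<close>

text \<open>For block diagonal \<open>s\<close> this is the direct sum of the Kronecker products of
  the blocks with identity matrices, one identity per attached graph. The test on \<open>b\<close>
  is essential, since the same \<open>h\<close> may be a vertex of several attached graphs.\<close>

definition lift_kernel :: "('a \<Rightarrow> nat) \<Rightarrow> ('a \<Rightarrow> 'a \<Rightarrow> complex) \<Rightarrow> 'a \<times> 'h \<Rightarrow> 'a \<times> 'h \<Rightarrow> complex" where
  "lift_kernel b s x y = (if b (fst x) = b (fst y) \<and> snd x = snd y then s (fst x) (fst y) else 0)"

text \<open>Only terms with second component \<open>h\<close> survive. The vertex
  \<open>(u, h)\<close> exists whenever \<open>s v u\<close> is nonzero, because \<open>u\<close>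
  then lies in the block of \<open>v\<close>.\<close>

lemma sum_lift_kernel_left:
  assumes "finite V" "\<And>v. v \<in> V \<Longrightarrow> finite (F (b v))"
    and "\<And>u. u \<in> V \<Longrightarrow> s v u \<noteq> 0 \<Longrightarrow> b v = b u"
    and "h \<in> F (b v)"
  shows "(\<Sum>y\<in>Sigma V (\<lambda>v. F (b v)). lift_kernel b s (v, h) y * g y) = (\<Sum>u\<in>V. s v u * g (u, h))"
proof -
  have "(\<Sum>y\<in>Sigma V (\<lambda>v. F (b v)). lift_kernel b s (v, h) y * g y) =
      (\<Sum>u\<in>V. \<Sum>k\<in>F (b u). lift_kernel b s (v, h) (u, k) * g (u, k))"
    using assms(1,2) by (subst sum.Sigma) (auto intro!: sum.cong)
  also have "\<dots> = (\<Sum>u\<in>V. s v u * g (u, h))"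
  proof (rule sum.cong[OF refl])
    fix u assume u: "u \<in> V"
    show "(\<Sum>k\<in>F (b u). lift_kernel b s (v, h) (u, k) * g (u, k)) = s v u * g (u, h)"
    proof (cases "b v = b u")
      case True
      have "(\<Sum>k\<in>F (b u). lift_kernel b s (v, h) (u, k) * g (u, k)) =
          (\<Sum>k\<in>F (b u). if k = h then s v u * g (u, h) else 0)"
        using True by (intro sum.cong) (auto simp: lift_kernel_def)
      then show ?thesis using True assms(2)[OF u] assms(4) by simp
    next
      case False
      then show ?thesis using assms(3)[OF u] by (auto simp: lift_kernel_def)
    qed
  qed
  finally show ?thesis .
qed

lemma sum_lift_kernel_right:
  assumes "finite V" "\<And>v. v \<in> V \<Longrightarrow> finite (F (b v))"
    and "\<And>u. u \<in> V \<Longrightarrow> s u w \<noteq> 0 \<Longrightarrow> b w = b u"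
    and "h \<in> F (b w)"
  shows "(\<Sum>y\<in>Sigma V (\<lambda>v. F (b v)). g y * lift_kernel b s y (w, h)) = (\<Sum>u\<in>V. g (u, h) * s u w)"
proof -
  \<comment> \<open>Lifting commutes with transposition, which reduces the claim to the left-hand
    version.\<close>
  have "lift_kernel b s y (w, h) = lift_kernel b (\<lambda>u v. s v u) (w, h) y" for y
    by (auto simp: lift_kernel_def)
  then show ?thesis
    using sum_lift_kernel_left[of V F b "\<lambda>u v. s v u" w h g] assms by (simp add: mult.commute)
qed

text \<open>The common shape of both product distances: only \<open>d\<close> distinguishes the two
  graphs, and the other terms see a base vertex through its block and through the test for
  equality.\<close>

definition shifted_kernel ::
  "('a \<Rightarrow> nat) \<Rightarrow> ('a \<Rightarrow> 'a \<Rightarrow> complex) \<Rightarrow> (nat \<Rightarrow> 'h \<Rightarrow> 'h \<Rightarrow> complex) \<Rightarrow> (nat \<Rightarrow> 'h \<Rightarrow> complex) \<Rightarrow>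
    (nat \<Rightarrow> 'h \<Rightarrow> complex) \<Rightarrow> 'a \<times> 'h \<Rightarrow> 'a \<times> 'h \<Rightarrow> complex" where
  "shifted_kernel b d \<kappa> \<alpha> \<beta> x y =
     d (fst x) (fst y) + (if fst x = fst y then \<kappa> (b (fst y)) (snd x) (snd y) else 0) +
     \<alpha> (b (fst x)) (snd x) + \<beta> (b (fst y)) (snd y)"

text \<open>\<open>rowcol\<close> is the entrywise form of \<open>S J = J S\<close>: the entry at
  \<open>v, w\<close> is a row sum on one side and a column sum on the other.\<close>

lemma lift_kernel_intertwines:
  assumes V: "finite V" "\<And>v. v \<in> V \<Longrightarrow> finite (F (b v))"
    and s: "\<And>u v. u \<in> V \<Longrightarrow> v \<in> V \<Longrightarrow> s u v \<noteq> 0 \<Longrightarrow> b u = b v"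
    and sd: "\<And>v w. v \<in> V \<Longrightarrow> w \<in> V \<Longrightarrow> (\<Sum>u\<in>V. s v u * d1 u w) = (\<Sum>u\<in>V. d2 v u * s u w)"
    and rowcol: "\<And>v w. v \<in> V \<Longrightarrow> w \<in> V \<Longrightarrow> (\<Sum>u\<in>V. s v u) = (\<Sum>u\<in>V. s u w)"
    and x: "x \<in> Sigma V (\<lambda>v. F (b v))" and z: "z \<in> Sigma V (\<lambda>v. F (b v))"
  shows "(\<Sum>y\<in>Sigma V (\<lambda>v. F (b v)). lift_kernel b s x y * shifted_kernel b d1 \<kappa> \<alpha> \<beta> y z) =
    (\<Sum>y\<in>Sigma V (\<lambda>v. F (b v)). shifted_kernel b d2 \<kappa> \<alpha> \<beta> x y * lift_kernel b s y z)"
proof -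
  obtain v h where vh: "x = (v, h)" "v \<in> V" "h \<in> F (b v)" using x by auto
  obtain w k where wk: "z = (w, k)" "w \<in> V" "k \<in> F (b w)" using z by auto
  have "(\<Sum>y\<in>Sigma V (\<lambda>v. F (b v)). lift_kernel b s x y * shifted_kernel b d1 \<kappa> \<alpha> \<beta> y z) =
      (\<Sum>u\<in>V. s v u * shifted_kernel b d1 \<kappa> \<alpha> \<beta> (u, h) z)"
    unfolding vh(1) by (rule sum_lift_kernel_left) (use V s vh in auto)
  \<comment> \<open>Where \<open>s v u\<close> is nonzero, \<open>b u = b v\<close>, so the
    \<open>\<alpha>\<close> term no longer depends on \<open>u\<close> and factors out of the
    sum.\<close>
  also have "\<dots> = (\<Sum>u\<in>V. s v u * d1 u w + (if u = w then s v w * \<kappa> (b w) h k else 0) +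
      (\<alpha> (b v) h + \<beta> (b w) k) * s v u)"
  proof (rule sum.cong[OF refl])
    fix u assume u: "u \<in> V"
    then show "s v u * shifted_kernel b d1 \<kappa> \<alpha> \<beta> (u, h) z =
      s v u * d1 u w + (if u = w then s v w * \<kappa> (b w) h k else 0) + (\<alpha> (b v) h + \<beta> (b w) k) * s v u"
      using s[OF vh(2) u] wk
      by (cases "s v u = 0") (auto simp: shifted_kernel_def algebra_simps)
  qed
  also have "\<dots> = (\<Sum>u\<in>V. s v u * d1 u w) + s v w * \<kappa> (b w) h k +
      (\<alpha> (b v) h + \<beta> (b w) k) * (\<Sum>u\<in>V. s v u)"
    using V wk by (simp add: sum.distrib sum_distrib_left)
  also have "\<dots> = (\<Sum>u\<in>V. d2 v u * s u w) + s v w * \<kappa> (b w) h k +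
      (\<alpha> (b v) h + \<beta> (b w) k) * (\<Sum>u\<in>V. s u w)"
    unfolding sd[OF vh(2) wk(2)] rowcol[OF vh(2) wk(2)] ..
  \<comment> \<open>The \<open>\<kappa>\<close> contribution, so far the term at
    \<open>u = w\<close>, is now placed at \<open>u = v\<close>. Its value is the same, because
    \<open>b v = b w\<close> whenever \<open>s v w\<close> is nonzero.\<close>
  also have "\<dots> = (\<Sum>u\<in>V. d2 v u * s u w + (if u = v then s v w * \<kappa> (b w) h k else 0) +
      (\<alpha> (b v) h + \<beta> (b w) k) * s u w)"
    using V vh by (simp add: sum.distrib sum_distrib_left)
  also have "\<dots> = (\<Sum>u\<in>V. shifted_kernel b d2 \<kappa> \<alpha> \<beta> x (u, k) * s u w)"
  proof (rule sum.cong[OF refl])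
    fix u assume u: "u \<in> V"
    then show "d2 v u * s u w + (if u = v then s v w * \<kappa> (b w) h k else 0) +
        (\<alpha> (b v) h + \<beta> (b w) k) * s u w = shifted_kernel b d2 \<kappa> \<alpha> \<beta> x (u, k) * s u w"
      using s[OF u wk(2)] vh
      by (cases "s u w = 0") (auto simp: shifted_kernel_def algebra_simps)
  qed
  also have "\<dots> = (\<Sum>y\<in>Sigma V (\<lambda>v. F (b v)). shifted_kernel b d2 \<kappa> \<alpha> \<beta> x y * lift_kernel b s y z)"
    unfolding wk(1) by (rule sum_lift_kernel_right[symmetric]) (use V s[OF _ wk(2), symmetric] wk in auto)
  finally show ?thesis .
qed

text \<open>The factor \<open>s v u\<close> confines \<open>u\<close> to the block of
  \<open>v\<close>, so for \<open>v\<close> and \<open>w\<close> in one block the entries of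
  \<open>s'\<close> cut off by the lift would contribute nothing. For different blocks every term
  vanishes, as it should since then \<open>x \<noteq> z\<close>.\<close>

lemma lift_kernel_right_inverse:
  assumes V: "finite V" "\<And>v. v \<in> V \<Longrightarrow> finite (F (b v))"
    and s: "\<And>u v. u \<in> V \<Longrightarrow> v \<in> V \<Longrightarrow> s u v \<noteq> 0 \<Longrightarrow> b u = b v"
    and inv: "\<And>v w. v \<in> V \<Longrightarrow> w \<in> V \<Longrightarrow> (\<Sum>u\<in>V. s v u * s' u w) = (if v = w then 1 else 0)"
    and x: "x \<in> Sigma V (\<lambda>v. F (b v))" and z: "z \<in> Sigma V (\<lambda>v. F (b v))"
  shows "(\<Sum>y\<in>Sigma V (\<lambda>v. F (b v)). lift_kernel b s x y * lift_kernel b s' y z) =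
    (if x = z then 1 else 0)"
proof -
  obtain v h where vh: "x = (v, h)" "v \<in> V" "h \<in> F (b v)" using x by auto
  obtain w k where wk: "z = (w, k)" "w \<in> V" "k \<in> F (b w)" using z by auto
  have "(\<Sum>y\<in>Sigma V (\<lambda>v. F (b v)). lift_kernel b s x y * lift_kernel b s' y z) =
      (\<Sum>u\<in>V. s v u * lift_kernel b s' (u, h) z)"
    unfolding vh(1) by (rule sum_lift_kernel_left) (use V s vh in auto)
  also have "\<dots> = (\<Sum>u\<in>V. if b v = b w \<and> h = k then s v u * s' u w else 0)"
  proof (rule sum.cong[OF refl])
    fix u assume u: "u \<in> V"
    show "s v u * lift_kernel b s' (u, h) z = (if b v = b w \<and> h = k then s v u * s' u w else 0)"
      using s[OF vh(2) u] wk by (cases "s v u = 0") (auto simp: lift_kernel_def)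
  qed
  also have "\<dots> = (if x = z then 1 else 0)"
    using inv[OF vh(2) wk(2)] vh wk by (cases "b v = b w \<and> h = k") auto
  finally show ?thesis .
qed

section \<open>From kernels to similar matrices\<close>

text \<open>The transformation has rows indexed by \<open>ys\<close> and columns by
  \<open>xs\<close>, so it absorbs the change of enumeration as well.\<close>

lemma similar_mat_of_kernels:
  fixes m1 m2 t t' :: "'p \<Rightarrow> 'p \<Rightarrow> complex"
  assumes xs: "distinct xs" "set xs = P" and ys: "distinct ys" "set ys = P"
    and comm: "\<And>x z. x \<in> P \<Longrightarrow> z \<in> P \<Longrightarrow> (\<Sum>y\<in>P. t x y * m1 y z) = (\<Sum>y\<in>P. m2 x y * t y z)"
    and inv: "\<And>x z. x \<in> P \<Longrightarrow> z \<in> P \<Longrightarrow> (\<Sum>y\<in>P. t x y * t' y z) = (if x = z then 1 else 0)"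
  shows "similar_mat (mat (length ys) (length ys) (\<lambda>(i, j). m2 (ys ! i) (ys ! j)))
           (mat (length xs) (length xs) (\<lambda>(i, j). m1 (xs ! i) (xs ! j)))"
proof -
  define N where "N = length xs"
  have N: "length xs = N" "length ys = N"
    using xs ys distinct_card[of xs] distinct_card[of ys] by (auto simp: N_def)
  let ?M1 = "mat N N (\<lambda>(i, j). m1 (xs ! i) (xs ! j))"
  let ?M2 = "mat N N (\<lambda>(i, j). m2 (ys ! i) (ys ! j))"
  let ?T = "mat N N (\<lambda>(i, j). t (ys ! i) (xs ! j))"
  let ?T' = "mat N N (\<lambda>(i, j). t' (xs ! i) (ys ! j))"
  have carr: "{?M2, ?M1, ?T, ?T'} \<subseteq> carrier_mat N N" by auto
  have sx: "(\<Sum>i\<in>{0..<N}. g (xs ! i)) = sum g P" for g :: "'p \<Rightarrow> complex"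
    using sum.reindex_bij_betw[OF bij_betw_nth[OF xs(1), of "{0..<N}" P], of g] xs N
    by (simp add: atLeast0LessThan)
  have sy: "(\<Sum>i\<in>{0..<N}. g (ys ! i)) = sum g P" for g :: "'p \<Rightarrow> complex"
    using sum.reindex_bij_betw[OF bij_betw_nth[OF ys(1), of "{0..<N}" P], of g] ys N
    by (simp add: atLeast0LessThan)
  have mem: "xs ! i \<in> P" "ys ! i \<in> P" if "i < N" for i
    using that xs ys N nth_mem by metis+
  have TT': "?T * ?T' = 1\<^sub>m N"
    by (rule eq_matI)
      (simp_all add: scalar_prod_def sx[of "\<lambda>y. t (ys ! _) y * t' y (ys ! _)"] inv mem
        nth_eq_iff_index_eq[OF ys(1)] N)
  \<comment> \<open>For square matrices a right inverse is also a left inverse.\<close>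
  have T'T: "?T' * ?T = 1\<^sub>m N"
    by (rule mat_mult_left_right_inverse[OF _ _ TT']) auto
  have comm': "?T * ?M1 = ?M2 * ?T"
    by (rule eq_matI)
      (simp_all add: scalar_prod_def sx[of "\<lambda>y. t (ys ! _) y * m1 y (xs ! _)"]
        sy[of "\<lambda>y. m2 (ys ! _) y * t y (xs ! _)"] comm mem)
  have "?T * ?M1 * ?T' = ?M2 * (?T * ?T')"
    unfolding comm' by (rule assoc_mult_mat[of _ N N _ N _ N]) auto
  then have "?M2 = ?T * ?M1 * ?T'" unfolding TT' by simp
  then have "similar_mat ?M2 ?M1"
    by (rule similar_matI[OF carr TT' T'T])
  then show ?thesis by (simp add: N)
qed

section \<open>Positions of the diagonal blocks\<close>

lemma sum_block_interval_exists:
  fixes d :: "nat \<Rightarrow> nat"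
  assumes "k < (\<Sum>j<l. d j)"
  shows "\<exists>i<l. (\<Sum>j<i. d j) \<le> k \<and> k < (\<Sum>j\<le>i. d j)"
  using assms
proof (induct l)
  case (Suc l)
  then show ?case
    by (cases "k < (\<Sum>j<l. d j)") (auto simp: less_Suc_eq lessThan_Suc_atMost not_less)
qed simp

lemma sum_block_interval_unique:
  fixes d :: "nat \<Rightarrow> nat"
  assumes "(\<Sum>j<i. d j) \<le> k" "k < (\<Sum>j\<le>i. d j)" "(\<Sum>j<i'. d j) \<le> k" "k < (\<Sum>j\<le>i'. d j)"
  shows "i = i'"
proof (rule ccontr)
  have *: False if "m < n" "k < (\<Sum>j\<le>m. d j)" "(\<Sum>j<n. d j) \<le> k" for m n
  proof -
    have "(\<Sum>j\<le>m. d j) \<le> (\<Sum>j<n. d j)" using that(1) by (intro sum_mono2) auto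
    then show False using that by simp
  qed
  assume "i \<noteq> i'"
  then show False using *[of i i'] *[of i' i] assms by (meson linorder_neqE_nat)
qed

text \<open>A nonzero entry lies in the head block or, with both indices shifted by its size, in the
  block matrix of the tail. Squareness of the blocks lets row counts delimit the columns
  too.\<close>

lemma diag_block_mat_nonzero:
  assumes "\<And>B. B \<in> set Bs \<Longrightarrow> square_mat B"
    and "k < dim_row (diag_block_mat Bs)" "m < dim_row (diag_block_mat Bs)"
    and "diag_block_mat Bs $$ (k, m) \<noteq> 0"
  shows "\<exists>i<length Bs. (\<Sum>j<i. dim_row (Bs ! j)) \<le> k \<and> k < (\<Sum>j\<le>i. dim_row (Bs ! j)) \<and>
           (\<Sum>j<i. dim_row (Bs ! j)) \<le> m \<and> m < (\<Sum>j\<le>i. dim_row (Bs ! j))"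
  using assms
proof (induct Bs arbitrary: k m)
  case (Cons A As)
  let ?D = "diag_block_mat As"
  have sq: "dim_col A = dim_row A" "dim_col ?D = dim_row ?D"
    using Cons.prems(1) diag_block_mat_square[of As] by auto
  have entry: "diag_block_mat (A # As) $$ (k, m) =
      (if k < dim_row A then if m < dim_row A then A $$ (k, m) else 0
       else if m < dim_row A then 0 else ?D $$ (k - dim_row A, m - dim_row A))"
    using Cons.prems(2,3) sq by (auto simp: Let_def)
  show ?case
  proof (cases "k < dim_row A")
    case True
    then have "m < dim_row A" using Cons.prems(4) entry by (auto split: if_splits)
    with True show ?thesis by (intro exI[of _ 0]) auto
  next
    case False
    then have m: "\<not> m < dim_row A" and nz: "?D $$ (k - dim_row A, m - dim_row A) \<noteq> 0"
      using Cons.prems(4) entry by (auto split: if_splits)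
    have "\<exists>i<length As. (\<Sum>j<i. dim_row (As ! j)) \<le> k - dim_row A \<and>
        k - dim_row A < (\<Sum>j\<le>i. dim_row (As ! j)) \<and>
        (\<Sum>j<i. dim_row (As ! j)) \<le> m - dim_row A \<and> m - dim_row A < (\<Sum>j\<le>i. dim_row (As ! j))"
      using Cons.prems False m nz by (intro Cons.hyps) (auto simp: Let_def)
    then obtain i where i: "i < length As" "(\<Sum>j<i. dim_row (As ! j)) \<le> k - dim_row A"
      "k - dim_row A < (\<Sum>j\<le>i. dim_row (As ! j))"
      "(\<Sum>j<i. dim_row (As ! j)) \<le> m - dim_row A" "m - dim_row A < (\<Sum>j\<le>i. dim_row (As ! j))"
      by blast
    have "(\<Sum>j<Suc i. dim_row ((A # As) ! j)) = dim_row A + (\<Sum>j<i. dim_row (As ! j))"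
      "(\<Sum>j\<le>Suc i. dim_row ((A # As) ! j)) = dim_row A + (\<Sum>j\<le>i. dim_row (As ! j))"
      by (simp_all add: sum.lessThan_Suc_shift sum.atMost_Suc_shift del: sum.lessThan_Suc sum.atMost_Suc)
    then show ?thesis using i False m by (intro exI[of _ "Suc i"]) auto
  qed
qed simp

text \<open>Turns the family of parts into a function from vertices to block numbers. Distinctness
  of \<open>vs\<close> makes the position of a vertex, and hence its block, unique.\<close>

lemma block_part_index:
  assumes "distinct vs" and "length vs = (\<Sum>j<length Bs. dim_row (Bs ! j))"
  obtains b where "\<And>v. v \<in> set vs \<Longrightarrow> b v < length Bs"
    and "\<And>i v. i < length Bs \<Longrightarrow> v \<in> block_part Bs vs i \<longleftrightarrow> v \<in> set vs \<and> b v = i"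
proof -
  let ?in = "\<lambda>i k. (\<Sum>j<i. dim_row (Bs ! j)) \<le> k \<and> k < (\<Sum>j\<le>i. dim_row (Bs ! j))"
  have ex: "\<exists>i<length Bs. v \<in> block_part Bs vs i" if v: "v \<in> set vs" for v
  proof -
    obtain k where k: "k < length vs" "v = vs ! k" using v by (auto simp: in_set_conv_nth)
    obtain i where "i < length Bs" "?in i k"
      using sum_block_interval_exists[of k "\<lambda>j. dim_row (Bs ! j)" "length Bs"] k assms(2) by auto
    then show ?thesis using k by (auto simp: block_part_def)
  qed
  \<comment> \<open>\<open>block_part\<close> takes \<open>vs ! k\<close> for all \<open>k\<close>
    in an interval; the block sizes add up to \<open>length vs\<close>, which keeps \<open>k\<close>
    inside the list.\<close>
  have bound: "k < length vs" if "i < length Bs" "?in i k" for i k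
  proof -
    have "(\<Sum>j\<le>i. dim_row (Bs ! j)) \<le> (\<Sum>j<length Bs. dim_row (Bs ! j))"
      using that(1) by (intro sum_mono2) auto
    then show ?thesis using that assms(2) by simp
  qed
  have unique: "i = i'" if i: "i < length Bs" "v \<in> block_part Bs vs i"
    and i': "i' < length Bs" "v \<in> block_part Bs vs i'" for i i' v
  proof -
    obtain k where k: "v = vs ! k" "?in i k" using i(2) by (auto simp: block_part_def)
    obtain k' where k': "v = vs ! k'" "?in i' k'" using i'(2) by (auto simp: block_part_def)
    have "k = k'"
      using k k' nth_eq_iff_index_eq[OF assms(1) bound[OF i(1) k(2)] bound[OF i'(1) k'(2)]] by simp
    then show ?thesis using k k' sum_block_interval_unique[of "\<lambda>j. dim_row (Bs ! j)" i k i'] by auto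
  qed
  have sub: "v \<in> set vs" if "i < length Bs" "v \<in> block_part Bs vs i" for i v
    using that bound by (auto simp: block_part_def)
  obtain b where b: "\<And>v. v \<in> set vs \<Longrightarrow> b v < length Bs \<and> v \<in> block_part Bs vs (b v)"
    using ex by metis
  show thesis
    by (rule that[of b]) (use b unique sub in blast)+
qed

section \<open>Assembling the similarity of the two products\<close>

theorem theorem3p3:
  fixes G1 G2 :: "'a pair_pre_digraph"
    and vs :: "'a list"
    and Bs :: "complex mat list"
    and S S_inv :: "complex mat"
    and H :: "nat \<Rightarrow> 'h pair_pre_digraph"
    and r :: "nat \<Rightarrow> 'h"
  assumes "connected_simple_graph G1"
    and "connected_simple_graph G2"
    and "vertex_enum G1 vs"
    and "vertex_enum G2 vs"
    and "dist_cospectral G1 G2"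
    and "\<And>B. B \<in> set Bs \<Longrightarrow> square_mat B"
    and "S = diag_block_mat Bs"
    and "similar_mat_wit (dist_mat G2 vs) (dist_mat G1 vs) S S_inv"
    and "S * all_ones_mat (length vs) = all_ones_mat (length vs) * S"
    and "\<And>i. i < length Bs \<Longrightarrow> rooted_graph (H i) (r i)"
  shows "dist_cospectral
           (rooted_product G1 (length Bs) (block_part Bs vs) H r)
           (rooted_product G2 (length Bs) (block_part Bs vs) H r)"
proof -
  define n where "n = length vs"
  define V where "V = set vs"
  have V: "pverts G1 = V" "pverts G2 = V" "distinct vs"
    using assms(3,4) by (auto simp: vertex_enum_def V_def)
  have D: "dist_mat G1 vs \<in> carrier_mat n n" "dist_mat G2 vs \<in> carrier_mat n n"
    by (auto simp: dist_mat_def n_def)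
  note wit = similar_mat_witD2[OF D(2) assms(8)]
  have dimS: "dim_row S = n" "dim_col S = n" "dim_row S_inv = n" "dim_col S_inv = n"
    using wit by auto
  have len: "length vs = (\<Sum>j<length Bs. dim_row (Bs ! j))"
    using dimS(1) dim_diag_block_mat(1)[of Bs] assms(7)
    by (simp add: n_def sum_list_sum_nth atLeast0LessThan)
  obtain b where b: "\<And>v. v \<in> V \<Longrightarrow> b v < length Bs"
    "\<And>i v. i < length Bs \<Longrightarrow> v \<in> block_part Bs vs i \<longleftrightarrow> v \<in> V \<and> b v = i"
    using block_part_index[OF V(3) len] unfolding V_def by blast
  have bij: "bij_betw ((!) vs) {0..<n} V"
    using V(3) by (intro bij_betw_nth) (auto simp: V_def n_def)
  \<comment> \<open>Inverting the enumeration turns the matrices into kernels on vertices, the form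
    that the lifting lemmas use.\<close>
  define idx where "idx = inv_into {0..<n} ((!) vs)"
  have idx: "idx v < n" "vs ! idx v = v" if "v \<in> V" for v
    using bij_betw_inv_into_right[OF bij that] bij_betwE[OF bij_betw_inv_into[OF bij]] that
    by (auto simp: idx_def)
  have idx_nth: "idx (vs ! i) = i" if "i < n" for i
    using bij_betw_inv_into_left[OF bij] that by (auto simp: idx_def)
  have sumV: "(\<Sum>u\<in>V. g u) = (\<Sum>i\<in>{0..<n}. g (vs ! i))" for g :: "'a \<Rightarrow> complex"
    by (rule sum.reindex_bij_betw[OF bij, symmetric])
  define s where "s = (\<lambda>u v. S $$ (idx u, idx v))"
  define s' where "s' = (\<lambda>u v. S_inv $$ (idx u, idx v))"
  have s: "b u = b v" if uv: "u \<in> V" "v \<in> V" "s u v \<noteq> 0" for u v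
  proof -
    obtain i where i: "i < length Bs"
      "(\<Sum>j<i. dim_row (Bs ! j)) \<le> idx u" "idx u < (\<Sum>j\<le>i. dim_row (Bs ! j))"
      "(\<Sum>j<i. dim_row (Bs ! j)) \<le> idx v" "idx v < (\<Sum>j\<le>i. dim_row (Bs ! j))"
      using diag_block_mat_nonzero[of Bs "idx u" "idx v"] assms(6,7) idx uv dimS
      by (auto simp: s_def)
    then have "u \<in> block_part Bs vs i" "v \<in> block_part Bs vs i"
      using idx(2)[OF uv(1), symmetric] idx(2)[OF uv(2), symmetric] by (auto simp: block_part_def)
    then show ?thesis using b(2)[OF i(1)] by simp
  qed
  have SD: "S * dist_mat G1 vs = dist_mat G2 vs * S"
  proof -
    \<comment> \<open>The witness says that \<open>dist_mat G2 vs\<close> is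
      \<open>S * dist_mat G1 vs * S_inv\<close>; multiplying by \<open>S\<close> on the right
      cancels \<open>S_inv\<close>.\<close>
    have "dist_mat G2 vs * S = S * dist_mat G1 vs * (S_inv * S)"
      using wit D by (simp add: assoc_mult_mat[of _ n n _ n _ n])
    then show ?thesis using wit D by simp
  qed
  have sd: "(\<Sum>u\<in>V. s v u * complex_of_nat (graph_dist G1 u w)) =
      (\<Sum>u\<in>V. complex_of_nat (graph_dist G2 v u) * s u w)" if "v \<in> V" "w \<in> V" for v w
    using arg_cong[OF SD, of "\<lambda>M. M $$ (idx v, idx w)"] idx[OF that(1)] idx[OF that(2)] D dimS
    by (simp add: scalar_prod_def sumV s_def idx_nth dist_mat_def n_def[symmetric])
  have rowcol: "(\<Sum>u\<in>V. s v u) = (\<Sum>u\<in>V. s u w)" if "v \<in> V" "w \<in> V" for v w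
    using arg_cong[OF assms(9), of "\<lambda>M. M $$ (idx v, idx w)"] idx[OF that(1)] idx[OF that(2)] dimS
    by (simp add: scalar_prod_def sumV s_def idx_nth all_ones_mat_def n_def[symmetric])
  have inv: "(\<Sum>u\<in>V. s v u * s' u w) = (if v = w then 1 else 0)" if "v \<in> V" "w \<in> V" for v w
  proof -
    have "idx v = idx w \<longleftrightarrow> v = w" using idx(2)[OF that(1)] idx(2)[OF that(2)] by metis
    then show ?thesis
      using arg_cong[OF wit(1), of "\<lambda>M. M $$ (idx v, idx w)"] idx(1)[OF that(1)] idx(1)[OF that(2)] dimS
      by (simp add: scalar_prod_def sumV s_def s'_def idx_nth)
  qed
  have finH: "finite (pverts (H i))" if "i < length Bs" for i
    using assms(10)[OF that] by (simp add: rooted_graph_def connected_simple_graph_wf)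
  let ?F = "\<lambda>i. pverts (H i)"
  define X where "X = Sigma V (\<lambda>v. ?F (b v))"
  have finV: "finite V" "\<And>v. v \<in> V \<Longrightarrow> finite (?F (b v))"
    using finH b by (auto simp: V_def)
  define \<alpha> where "\<alpha> = (\<lambda>i h. complex_of_nat (graph_dist (H i) h (r i)))"
  define \<beta> where "\<beta> = (\<lambda>i h. complex_of_nat (graph_dist (H i) (r i) h))"
  \<comment> \<open>Within one copy the detour over the root, \<open>\<alpha> + \<beta>\<close>, is
    still added and \<open>d v v = 0\<close>; subtracting the detour here leaves the distance inside
    the copy. The subtraction takes place in the complex numbers, so nothing is truncated.\<close>
  define \<kappa> where "\<kappa> = (\<lambda>i h k. complex_of_nat (graph_dist (H i) h k) - \<alpha> i h - \<beta> i k)"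
  \<comment> \<open>Stated for any base graph on \<open>V\<close>, so that both products share the
    index set \<open>X\<close> and the terms \<open>\<kappa>\<close>, \<open>\<alpha>\<close>,
    \<open>\<beta>\<close>.\<close>
  have prod: "pverts P = X"
    "\<And>x y. x \<in> X \<Longrightarrow> y \<in> X \<Longrightarrow> complex_of_nat (graph_dist P x y) =
      shifted_kernel b (\<lambda>u v. complex_of_nat (graph_dist G u v)) \<kappa> \<alpha> \<beta> x y"
    if P: "P = rooted_product G (length Bs) (block_part Bs vs) H r"
      and G: "connected_simple_graph G" "pverts G = V" for P G
  proof -
    have bG: "\<And>v. v \<in> pverts G \<Longrightarrow> b v < length Bs"
      "\<And>i v. i < length Bs \<Longrightarrow> v \<in> block_part Bs vs i \<longleftrightarrow> v \<in> pverts G \<and> b v = i"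
      using b G(2) by simp_all
    note dist = graph_dist_rooted_product[where G = G and l = "length Bs" and H = H and r = r
        and b = b and V = "block_part Bs vs", OF G(1) assms(10) bG, folded P, unfolded G(2)]
    show X: "pverts P = X" using dist(1) by (simp add: X_def)
    fix x y assume xy: "x \<in> X" "y \<in> X"
    have "graph_dist G v v = 0" if "v \<in> V" for v
      using connected_simple_graph_is_distance[OF G(1)] G(2) that by (auto simp: is_distance_def)
    then show "complex_of_nat (graph_dist P x y) =
      shifted_kernel b (\<lambda>u v. complex_of_nat (graph_dist G u v)) \<kappa> \<alpha> \<beta> x y"
      using dist(2)[of x y] X xy
      by (auto simp: product_dist_def shifted_kernel_def \<kappa>_def \<alpha>_def \<beta>_def X_def)
  qed
  let ?P1 = "rooted_product G1 (length Bs) (block_part Bs vs) H r"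
  let ?P2 = "rooted_product G2 (length Bs) (block_part Bs vs) H r"
  note prod1 = prod[OF refl assms(1) V(1)] and prod2 = prod[OF refl assms(2) V(2)]
  have "spectrum_mset (dist_mat ?P1 xs) = spectrum_mset (dist_mat ?P2 ys)"
    if "vertex_enum ?P1 xs" "vertex_enum ?P2 ys" for xs ys
  proof -
    have xs: "distinct xs" "set xs = X" and ys: "distinct ys" "set ys = X"
      using that prod1(1) prod2(1) by (auto simp: vertex_enum_def)
    let ?m = "\<lambda>G. shifted_kernel b (\<lambda>u v. complex_of_nat (graph_dist G u v)) \<kappa> \<alpha> \<beta>"
    have "similar_mat (mat (length ys) (length ys) (\<lambda>(i, j). ?m G2 (ys ! i) (ys ! j)))
        (mat (length xs) (length xs) (\<lambda>(i, j). ?m G1 (xs ! i) (xs ! j)))"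
    proof (rule similar_mat_of_kernels[OF xs ys, where t = "lift_kernel b s" and t' = "lift_kernel b s'"])
      fix x z assume xz: "x \<in> X" "z \<in> X"
      show "(\<Sum>y\<in>X. lift_kernel b s x y * ?m G1 y z) = (\<Sum>y\<in>X. ?m G2 x y * lift_kernel b s y z)"
        using xz unfolding X_def
        by (intro lift_kernel_intertwines[where F = ?F and b = b and V = V] finV s sd rowcol)
      show "(\<Sum>y\<in>X. lift_kernel b s x y * lift_kernel b s' y z) = (if x = z then 1 else 0)"
        using xz unfolding X_def
        by (intro lift_kernel_right_inverse[where F = ?F and b = b and V = V] finV s inv)
    qed
    moreover have "mat (length ys) (length ys) (\<lambda>(i, j). ?m G2 (ys ! i) (ys ! j)) = dist_mat ?P2 ys"
      unfolding dist_mat_def using ys nth_mem by (intro cong_mat) (auto simp: prod2(2))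
    moreover have "mat (length xs) (length xs) (\<lambda>(i, j). ?m G1 (xs ! i) (xs ! j)) = dist_mat ?P1 xs"
      unfolding dist_mat_def using xs nth_mem by (intro cong_mat) (auto simp: prod1(2))
    ultimately show ?thesis
      by (simp add: spectrum_mset_def char_poly_similar)
  qed
  moreover have "finite X" using finV by (auto simp: X_def)
  ultimately show ?thesis
    using prod1(1) prod2(1) by (simp add: dist_cospectral_def)
qed

end
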